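(* Let $F$ be a cellular automaton on $\mathcal{X}=\mathcal{A}^{\mathbb{Z}}$ whose neighborhood $\mathcal{N}$ is an interval of $\mathbb{Z}$ with length $|\mathcal{N}|=r$, admitting $0\in\mathcal{A}$ as a spreading state, and let $(F_\epsilon)_{\epsilon>0}$ be a family of $0$-positive $\epsilon$-perturbations of $F$. For all $\epsilon>0$, let $\pi_\epsilon$ be an $F_\epsilon$-invariant probability measure. Then for every finite interval $A\subset\mathbb{Z}$ there is a constant $C_{|A|}$ such that $$\|\delta_0-\pi_\epsilon\|_A\le 1-(1-\epsilon)^{C_{|A|}}\cdot\left(1-\frac{27\epsilon}{1-27\epsilon}\right)\underset{\epsilon\to0}{\sim}\left(C_{|A|}+27\right)\epsilon.$$
   Context: $\mathcal{A}$ is a finite alphabet and $\mathcal{X}=\mathcal{A}^{\mathbb{Z}}$ has the product topology. A map $F:\mathcal{X}\to\mathcal{X}$ is a cellular automaton (CA) if there are a finite neighborhood $\mathcal{N}=\{i_1,\dots,i_r\}\subset\mathbb{Z}$ and a local rule $f:\mathcal{A}^{\mathcal{N}}\to\mathcal{A}$ with $(Fx)_i=f(x_{i+\mathcal{N}})$ for all $i$, where $x_{i+\mathcal{N}}=(x_{i+i_1},\dots,x_{i+i_r})$. A transition kernel $\Phi$ on $\mathcal{X}$ is a probabilistic cellular automaton (PCA) if there are a finite neighborhood $\mathcal{N}$ and a stochastic matrix $\varphi:\mathcal{A}^{\mathcal{N}}\times\mathcal{A}\to[0,1]$ (local rule) such that for all $x\in\mathcal{X}$, finite $A\subset\mathbb{Z}$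 and $u\in\mathcal{A}^A$, $\Phi(x,[u]_A)=\prod_{i\in A}\varphi(x_{i+\mathcal{N}},u_i)$, where $[u]_A=\{y\in\mathcal{X}: y_i=u_i\ \forall i\in A\}$. A PCA with local rule $\varphi$ is an $\epsilon$-perturbation of a CA with local rule $f$ if they have the same alphabet and the same neighborhood, and $\varphi((a_1,\dots,a_r),f(a_1,\dots,a_r))\ge1-\epsilon$ for all $a_1,\dots,a_r\in\mathcal{A}$. It is $0$-positive if $\varphi((a_1,\dots,a_r),0)>0$ for all $a_1,\dots,a_r\in\mathcal{A}$. In the family $(F_\epsilon)_{\epsilon>0}$, each $F_\epsilon$ is a $0$-positive $\epsilon$-perturbation of $F$. $F$ admits $0\in\mathcal{A}$ as a spreading state if for every configuration $x$ and every $i$: whenever there is $j\in\mathcal{N}$ with $x_{i+j}=0$, then $(Fx)_i=0$. A PCA acts on Borel probability measures by $\Phi\mu(B)=\int\Phi(x,B)\,d\mu(x)$; $\mu$ is $\Phi$-invariant if $\Phi\mu=\mu$. $\delta_0$ is the Dirac mass at the configuration $0^\infty$ with all cells equal to $0$. For finite $A\subset\mathbb{Z}$ and probability measures $\mu,\nu$ on $\mathcal{X}$, $\|\mu-\nu\|_A=\frac12\sum_{u\in\mathcal{A}^A}|\mu([u]_A)-\nu([u]_A)|$. The notation $C_{|A|}$ indicates a constant depending on $A$ through its cardinality $|A|$.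
   Formalization: The neighborhood is assumed to have length r ≥ 2 (for r = 1 the identity automaton is a counterexample), and the inequality is stated for 0 < ε < 1/27 (the bound is undefined at 1/27 and negative just above it). *)

theory Defs
  imports "HOL-Probability.Probability" "HOL-Library.Landau_Symbols"
begin

type_synonym 'a config = "int \<Rightarrow> 'a"

(* The measurable space of configurations. The product sigma-algebra is the Borel
   sigma-algebra of the product topology; see sets_configs_borel below. *)
definition configs :: "'a config measure" where
  "configs = (\<Pi>\<^sub>M i\<in>UNIV. count_space UNIV)"

definition cylinder :: "int set \<Rightarrow> 'a config \<Rightarrow> 'a config set" where
  "cylinder A u = {y. \<forall>i\<in>A. y i = u i}"

(* The pattern seen from cell i through the neighborhood N. Patterns, the elements of A^N,
   are the extensional functions in N \<rightarrow>\<^sub>E UNIV. *)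
definition window :: "int set \<Rightarrow> 'a config \<Rightarrow> int \<Rightarrow> 'a config" where
  "window N x i = (\<lambda>j\<in>N. x (i + j))"

definition is_CA :: "int set \<Rightarrow> ('a config \<Rightarrow> 'a) \<Rightarrow> ('a config \<Rightarrow> 'a config) \<Rightarrow> bool" where
  "is_CA N f F \<longleftrightarrow> finite N \<and> (\<forall>x i. F x i = f (window N x i))"

definition spreading_state :: "int set \<Rightarrow> ('a config \<Rightarrow> 'a config) \<Rightarrow> 'a \<Rightarrow> bool" where
  "spreading_state N F z \<longleftrightarrow> (\<forall>x i. (\<exists>j\<in>N. x (i + j) = z) \<longrightarrow> F x i = z)"

definition stochastic_rule :: "int set \<Rightarrow> ('a::finite config \<Rightarrow> 'a \<Rightarrow> real) \<Rightarrow> bool" where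
  "stochastic_rule N \<phi> \<longleftrightarrow>
     (\<forall>p \<in> N \<rightarrow>\<^sub>E UNIV. (\<forall>a. 0 \<le> \<phi> p a) \<and> (\<Sum>a\<in>UNIV. \<phi> p a) = 1)"

definition is_PCA ::
  "int set \<Rightarrow> ('a::finite config \<Rightarrow> 'a \<Rightarrow> real) \<Rightarrow> ('a config \<Rightarrow> 'a config measure) \<Rightarrow> bool" where
  "is_PCA N \<phi> \<Phi> \<longleftrightarrow>
     finite N \<and> stochastic_rule N \<phi> \<and> \<Phi> \<in> configs \<rightarrow>\<^sub>M prob_algebra configs \<and>
     (\<forall>x A. finite A \<longrightarrow> (\<forall>u \<in> A \<rightarrow>\<^sub>E UNIV.
        measure (\<Phi> x) (cylinder A u) = (\<Prod>i\<in>A. \<phi> (window N x i) (u i))))"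

definition eps_perturbation ::
  "real \<Rightarrow> int set \<Rightarrow> ('a config \<Rightarrow> 'a) \<Rightarrow> ('a config \<Rightarrow> 'a \<Rightarrow> real) \<Rightarrow> bool" where
  "eps_perturbation \<epsilon> N f \<phi> \<longleftrightarrow> (\<forall>p \<in> N \<rightarrow>\<^sub>E UNIV. \<phi> p (f p) \<ge> 1 - \<epsilon>)"

definition state_positive :: "int set \<Rightarrow> 'a \<Rightarrow> ('a config \<Rightarrow> 'a \<Rightarrow> real) \<Rightarrow> bool" where
  "state_positive N z \<phi> \<longleftrightarrow> (\<forall>p \<in> N \<rightarrow>\<^sub>E UNIV. \<phi> p z > 0)"

definition config_prob :: "'a config measure \<Rightarrow> bool" where
  "config_prob \<mu> \<longleftrightarrow> prob_space \<mu> \<and> sets \<mu> = sets configs"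

(* The action of a kernel on measures is the monadic bind; see emeasure_kernel_action. *)
definition invariant_prob ::
  "('a config \<Rightarrow> 'a config measure) \<Rightarrow> 'a config measure \<Rightarrow> bool" where
  "invariant_prob \<Phi> \<mu> \<longleftrightarrow> config_prob \<mu> \<and> \<mu> \<bind> \<Phi> = \<mu>"

definition dirac_const :: "'a \<Rightarrow> 'a config measure" where
  "dirac_const z = return configs (\<lambda>_. z)"

definition tv_on :: "int set \<Rightarrow> 'a config measure \<Rightarrow> 'a config measure \<Rightarrow> real" where
  "tv_on A \<mu> \<nu> =
     (1/2) * (\<Sum>u \<in> A \<rightarrow>\<^sub>E UNIV. \<bar>measure \<mu> (cylinder A u) - measure \<nu> (cylinder A u)\<bar>)"

lemma space_configs: "space configs = UNIV"
  by (simp add: configs_def space_PiM)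

lemma cylinder_in_sets:
  assumes "finite A"
  shows "cylinder A u \<in> sets (configs :: 'a config measure)"
proof -
  have "{y \<in> space (configs :: 'a config measure). \<forall>i\<in>A. y i = u i} \<in> sets configs"
  proof (rule sets.sets_Collect_finite_All)
    fix i assume "i \<in> A"
    have "(\<lambda>y. y i) \<in> (configs :: 'a config measure) \<rightarrow>\<^sub>M count_space UNIV"
      unfolding configs_def by (rule measurable_component_singleton) simp
    from measurable_sets[OF this, of "{u i}"]
    show "{y \<in> space (configs :: 'a config measure). y i = u i} \<in> sets configs"
      by (simp add: vimage_def Int_def conj_commute)
  qed (rule assms)
  then show ?thesis
    by (simp add: cylinder_def space_configs)
qed

lemma sets_configs_borel:
  "sets (configs :: 'a::finite config measure) =
     sigma_sets UNIV {U. openin (product_topology (\<lambda>_. discrete_topology UNIV) UNIV) U}"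
  (is "_ = sigma_sets UNIV ?O")
proof
  have "{f :: 'a config. f i \<in> B} \<in> ?O" for i B
  proof -
    have "openin (product_topology (\<lambda>_. discrete_topology UNIV) UNIV)
        {x \<in> topspace (product_topology (\<lambda>_. discrete_topology (UNIV :: 'a set)) UNIV). x i \<in> B}"
      by (rule openin_continuous_map_preimage[OF continuous_map_product_projection]) auto
    then show ?thesis by simp
  qed
  then have "{{f \<in> \<Pi>\<^sub>E i\<in>UNIV. space (count_space (UNIV :: 'a set)). f i \<in> B} | i B.
      (i :: int) \<in> UNIV \<and> B \<in> sets (count_space UNIV)} \<subseteq> ?O"
    by auto
  then show "sets configs \<subseteq> sigma_sets UNIV ?O"
    unfolding configs_def sets_PiM_single by (simp add: sigma_sets_mono')
next
  have "S \<in> sets configs" if S: "S \<in> ?O" for S :: "'a config set"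
  proof -
    define I where "I = (SIGMA J : {J :: int set. finite J}. J \<rightarrow>\<^sub>E (UNIV :: 'a set))"
    have cI: "countable I"
      unfolding I_def
      by (intro countable_SIGMA countable_Collect_finite countable_finite finite_PiE) auto
    define K where "K = {p \<in> I. cylinder (fst p) (snd p) \<subseteq> S}"
    have "x \<in> (\<Union>p\<in>K. cylinder (fst p) (snd p))" if "x \<in> S" for x
    proof -
      obtain V where V: "finite {i \<in> UNIV. V i \<noteq> (UNIV :: 'a set)}"
        "x \<in> Pi\<^sub>E UNIV V" "Pi\<^sub>E UNIV V \<subseteq> S"
        using S \<open>x \<in> S\<close> by (auto simp: openin_product_topology_alt)
      define J where "J = {i. V i \<noteq> UNIV}"
      have "cylinder J (restrict x J) \<subseteq> Pi\<^sub>E UNIV V"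
        using V(2) by (fastforce simp: cylinder_def J_def PiE_iff)
      moreover have "(J, restrict x J) \<in> I"
        using V(1) by (auto simp: I_def J_def)
      ultimately have "(J, restrict x J) \<in> K"
        unfolding K_def using V(3) by simp
      moreover have "x \<in> cylinder J (restrict x J)"
        by (simp add: cylinder_def)
      ultimately show ?thesis
        by (intro UN_I[of "(J, restrict x J)"]) simp_all
    qed
    then have "S = (\<Union>p\<in>K. cylinder (fst p) (snd p))"
      unfolding K_def by (intro equalityI subsetI) (assumption | blast)+
    also have "\<dots> \<in> sets configs"
    proof (rule sets.countable_UN'')
      show "countable K"
        using cI by (rule countable_subset[rotated]) (simp add: K_def)
      show "cylinder (fst p) (snd p) \<in> sets configs" if "p \<in> K" for p
        using that by (intro cylinder_in_sets) (auto simp: K_def I_def)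
    qed
    finally show ?thesis .
  qed
  then show "sigma_sets UNIV ?O \<subseteq> sets configs"
    using sets.sigma_sets_subset[of ?O configs] by (auto simp: space_configs)
qed

lemma emeasure_kernel_action:
  assumes "config_prob \<mu>" and "\<Phi> \<in> configs \<rightarrow>\<^sub>M prob_algebra configs" and "B \<in> sets configs"
  shows "emeasure (\<mu> \<bind> \<Phi>) B = (\<integral>\<^sup>+ x. emeasure (\<Phi> x) B \<partial>\<mu>)"
proof (rule emeasure_bind)
  show "space \<mu> \<noteq> {}"
    using assms(1) unfolding config_prob_def by (metis prob_space.not_empty)
  show "\<Phi> \<in> \<mu> \<rightarrow>\<^sub>M subprob_algebra configs"
    using assms(1,2) unfolding config_prob_def
    by (metis measurable_cong_sets measurable_prob_algebraD)
qed (rule assms(3))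

end

theory Submission
  imports Defs
begin

text \<open>Why does an invariant measure \<open>\<pi>\<close> of the perturbed automaton give almost full mass to the state \<open>z\<close>? Go
backwards in time from a cell that is not in state \<open>z\<close>. Either an error occurred there, which has
probability at most \<open>\<epsilon>\<close>, or all cells of its neighborhood, in particular two adjacent ones, were not in
state \<open>z\<close> one step before. Hence the probability \<open>h S\<close> that \<open>\<pi>\<close> avoids \<open>z\<close> on the finite set \<open>S\<close> is at
most the mean of \<open>h\<close> over one step of an oriented percolation process on finite sets
(\<open>prob_no_z_subharmonic\<close>). Since every cell turns into \<open>z\<close> with a probability bounded away from zero,
\<open>h S\<close> decays exponentially in the cardinality of \<open>S\<close> (\<open>prob_no_z_decay\<close>). A maximum principle
(\<open>subharmonic_le_extinct\<close>) then bounds \<open>h S\<close> by the extinction probability of the percolation process,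
up to an arbitrarily small error.

Extinction from one cell is bounded by a Peierls argument (\<open>extinct_singleton_le\<close>). It forces a
contour, a walk across the cell made of three kinds of steps that occur equally often up to one, where
one kind passes over pairwise distinct errors. There are at most \<open>27 ^ m\<close> contours with \<open>m\<close> errors,
each present with probability at most \<open>\<epsilon> ^ m\<close>, which gives \<open>27 * \<epsilon> / (1 - 27 * \<epsilon>)\<close>.

Finally, from a single cell in state \<open>z\<close> this state spreads over a cone of growing intervals, as long as
no error occurs in the cone (\<open>prob_all_z_cone\<close>). A cone that covers \<open>{a..b}\<close> has, besides its apex, a number of
points that depends only on the length of the interval and on the neighborhood; this number is the exponent in
the bound. On \<open>{a..b}\<close> the total variation distance to the Dirac mass is the probability
that some cell is not in state \<open>z\<close> (\<open>tv_on_dirac_const\<close>).\<close>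

section \<open>Independent random subsets of a finite set\<close>

text \<open>The expectation of \<open>g\<close> on the random subset of \<open>A\<close> that retains each element independently with
probability \<open>q\<close>. All the randomness of the percolation argument lives in finite sets, so a finite
sum replaces a probability space.\<close>
definition bern :: "real \<Rightarrow> 'b set \<Rightarrow> ('b set \<Rightarrow> real) \<Rightarrow> real" where
  "bern q A g = (\<Sum>X\<in>Pow A. q ^ card X * (1 - q) ^ card (A - X) * g X)"

lemma bern_cong: "(\<And>X. X \<subseteq> A \<Longrightarrow> g X = g' X) \<Longrightarrow> bern q A g = bern q A g'"
  unfolding bern_def by (intro sum.cong) auto

lemma bern_mono:
  assumes "0 \<le> q" "q \<le> 1" "\<And>X. X \<subseteq> A \<Longrightarrow> g X \<le> g' X"
  shows "bern q A g \<le> bern q A g'"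
  unfolding bern_def using assms by (intro sum_mono mult_left_mono) auto

text \<open>This identity turns the one-step estimate for the automaton, a product over cells, into an average
over sets of cells where an error occurs.\<close>
lemma bern_prod:
  assumes "finite A"
  shows "bern q A (\<lambda>X. \<Prod>i\<in>A - X. g i) = (\<Prod>i\<in>A. q + (1 - q) * g i)"
  by (simp add: prod_add[OF assms] bern_def prod.distrib mult.assoc)

lemma bern_const:
  assumes "finite A"
  shows "bern q A (\<lambda>_. c) = c"
proof -
  have "bern q A (\<lambda>_. 1) = 1"
    using bern_prod[OF assms, of q "\<lambda>_. 1"] by simp
  then show ?thesis
    by (simp add: bern_def flip: sum_distrib_right)
qed

lemma bern_sum: "bern q A (\<lambda>X. \<Sum>i\<in>I. g i X) = (\<Sum>i\<in>I. bern q A (g i))"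
  unfolding bern_def sum_distrib_left by (rule sum.swap)

text \<open>The restrictions of the random subset to disjoint sets are independent; this is Fubini for \<open>bern\<close>.\<close>
lemma bern_union:
  assumes fin: "finite A" "finite B" and disj: "A \<inter> B = {}"
  shows "bern q (A \<union> B) g = bern q A (\<lambda>X. bern q B (\<lambda>Y. g (X \<union> Y)))"
proof -
  have "bern q A (\<lambda>X. bern q B (\<lambda>Y. g (X \<union> Y)))
      = (\<Sum>(X, Y)\<in>Pow A \<times> Pow B. (q ^ card X * (1 - q) ^ card (A - X))
          * ((q ^ card Y * (1 - q) ^ card (B - Y)) * g (X \<union> Y)))"
    unfolding bern_def sum_distrib_left sum.cartesian_product by (simp add: mult.assoc)
  also have "\<dots> = bern q (A \<union> B) g"
    unfolding bern_def
  proof (rule sum.reindex_bij_witness[where i = "\<lambda>Z. (Z \<inter> A, Z \<inter> B)" and j = "\<lambda>(X, Y). X \<union> Y"])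
    fix p assume "p \<in> Pow A \<times> Pow B"
    then obtain X Y where p: "p = (X, Y)" "X \<subseteq> A" "Y \<subseteq> B" by auto
    have c: "card (X \<union> Y) = card X + card Y"
      using p fin disj by (intro card_Un_disjoint) (auto intro: finite_subset)
    have "A \<union> B - (X \<union> Y) = (A - X) \<union> (B - Y)"
      using p disj by auto
    moreover have "card ((A - X) \<union> (B - Y)) = card (A - X) + card (B - Y)"
      using fin disj by (intro card_Un_disjoint) auto
    ultimately have "card (A \<union> B - (X \<union> Y)) = card (A - X) + card (B - Y)" by simp
    with p c show "q ^ card (case p of (X, Y) \<Rightarrow> X \<union> Y)
        * (1 - q) ^ card (A \<union> B - (case p of (X, Y) \<Rightarrow> X \<union> Y)) * g (case p of (X, Y) \<Rightarrow> X \<union> Y)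
      = (case p of (X, Y) \<Rightarrow> (q ^ card X * (1 - q) ^ card (A - X))
          * ((q ^ card Y * (1 - q) ^ card (B - Y)) * g (X \<union> Y)))"
      by (simp add: power_add)
  qed (use disj in auto)
  finally show ?thesis by simp
qed

lemma bern_superset:
  assumes "finite A"
  shows "bern q A (\<lambda>X. of_bool (C \<subseteq> X)) = (if C \<subseteq> A then q ^ card C else 0)"
proof (cases "C \<subseteq> A")
  case True
  have "bern q A (\<lambda>X. of_bool (C \<subseteq> X)) = bern q (C \<union> (A - C)) (\<lambda>X. of_bool (C \<subseteq> X))"
    using True by (simp add: Un_absorb1)
  also have "\<dots> = bern q C (\<lambda>X. bern q (A - C) (\<lambda>Y. of_bool (C \<subseteq> X \<union> Y)))"
    using True assms by (intro bern_union) (auto intro: finite_subset)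
  also have "\<dots> = bern q C (\<lambda>X. bern q (A - C) (\<lambda>Y. of_bool (X = C)))"
    by (intro bern_cong arg_cong[where f = of_bool]) auto
  also have "\<dots> = bern q C (\<lambda>X. of_bool (X = C))"
    using assms by (simp add: bern_const)
  also have "\<dots> = (\<Sum>X\<in>Pow C. if X = C then q ^ card C else 0)"
    unfolding bern_def by (intro sum.cong) auto
  also have "\<dots> = q ^ card C"
    using True assms by (simp add: finite_subset)
  finally show ?thesis using True by simp
next
  case False
  then show ?thesis unfolding bern_def by (intro trans[OF sum.neutral]) auto
qed

section \<open>The dual percolation process and the comparison principle\<close>

text \<open>If cell \<open>i\<close> is not in the spreading state although no error occurred there, then one step earlier the
cells \<open>i + k\<close> and \<open>i + k + 1\<close> were not in that state. Looking at two cells of the neighborhood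
suffices for the bound and makes the process planar.\<close>
definition offspring :: "int \<Rightarrow> int set \<Rightarrow> int set" where
  "offspring k S = (\<lambda>i. i + k) ` S \<union> (\<lambda>i. i + k + 1) ` S"

lemma finite_offspring: "finite S \<Longrightarrow> finite (offspring k S)"
  by (simp add: offspring_def)

lemma offspring_empty [simp]: "offspring k {} = {}"
  by (simp add: offspring_def)

text \<open>The probability that the dual process started from \<open>S\<close> has died out after \<open>T\<close> steps: in each step
every cell is deleted with probability \<open>q\<close> and the others are replaced by their offspring.\<close>
fun extinct :: "real \<Rightarrow> int \<Rightarrow> nat \<Rightarrow> int set \<Rightarrow> real" where
  "extinct q k 0 S = of_bool (S = {})"
| "extinct q k (Suc T) S = bern q S (\<lambda>X. extinct q k T (offspring k (S - X)))"

lemma extinct_empty: "extinct q k T {} = 1"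
  by (induction T) (simp_all add: bern_def)

lemma extinct_nonneg: "0 \<le> q \<Longrightarrow> q \<le> 1 \<Longrightarrow> 0 \<le> extinct q k T S"
  by (induction T arbitrary: S) (auto simp: bern_def intro!: sum_nonneg)

text \<open>A maximum principle. Let \<open>a\<close> bound \<open>h - extinct\<close> after \<open>T\<close> steps. One further step multiplies the
bound at \<open>S\<close> by \<open>1 - q ^ card S\<close>, because with probability \<open>q ^ card S\<close> the whole of \<open>S\<close> is deleted
and on the empty set \<open>h\<close> does not exceed the extinction probability. This is a contraction uniformly
over sets of at most \<open>n\<close> cells, whereas on larger sets \<open>h\<close> itself is at most \<open>\<rho> ^ n\<close>. Applied to a
stationary measure, the lemma says that a dual process that survives reaches so many cells that they
cannot all avoid the spreading state.\<close>
lemma subharmonic_le_extinct: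
  fixes h :: "int set \<Rightarrow> real"
  assumes q: "0 < q" "q \<le> 1" and \<rho>: "0 \<le> \<rho>" "\<rho> < 1" and "\<eta> > 0"
    and sub: "\<And>S. finite S \<Longrightarrow> h S \<le> bern q S (\<lambda>X. h (offspring k (S - X)))"
    and decay: "\<And>S. finite S \<Longrightarrow> h S \<le> \<rho> ^ card S"
  shows "\<exists>T. \<forall>S. finite S \<longrightarrow> h S \<le> extinct q k T S + \<eta>"
proof -
  obtain n where n: "\<rho> ^ n < \<eta>"
    using real_arch_pow_inv[OF \<open>\<eta> > 0\<close> \<rho>(2)] by blast
  define \<theta> where "\<theta> = 1 - q ^ n"
  have \<theta>: "0 \<le> \<theta>" "\<theta> < 1"
    using q by (auto simp: \<theta>_def power_le_one)
  have h1: "h S \<le> 1" if "finite S" for S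
    using decay[OF that] power_le_one[of \<rho> "card S"] \<rho> by linarith
  have step: "h S \<le> extinct q k T S + max (\<theta> ^ T) \<eta>" if "finite S" for S T
    using that
  proof (induction T arbitrary: S)
    case 0
    have "0 \<le> extinct q k 0 S" using q by (intro extinct_nonneg) auto
    moreover have "1 \<le> max (\<theta> ^ 0) \<eta>" by simp
    ultimately show ?case using h1[OF 0] by linarith
  next
    case (Suc T)
    define a where "a = max (\<theta> ^ T) \<eta>"
    have a: "0 \<le> a" "\<theta> ^ T \<le> a" "\<eta> \<le> a" using \<open>\<eta> > 0\<close> by (auto simp: a_def)
    show ?case
    proof (cases "card S \<le> n")
      case True
      have "h S \<le> bern q S (\<lambda>X. h (offspring k (S - X)))" by (rule sub) fact
      also have "\<dots> \<le> bern q S (\<lambda>X. extinct q k T (offspring k (S - X)) + a - a * of_bool (S \<subseteq> X))"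
      proof (rule bern_mono)
        fix X assume "X \<subseteq> S"
        show "h (offspring k (S - X))
          \<le> extinct q k T (offspring k (S - X)) + a - a * of_bool (S \<subseteq> X)"
        proof (cases "S \<subseteq> X")
          case True
          then have "S - X = {}" by auto
          then show ?thesis using True h1[of "{}"] by (simp only: offspring_empty extinct_empty) simp
        next
          case False
          then show ?thesis
            using Suc.IH[of "offspring k (S - X)"] Suc.prems by (simp add: finite_offspring a_def)
        qed
      qed (use q in auto)
      also have "\<dots> = extinct q k (Suc T) S + bern q S (\<lambda>X. a) - a * bern q S (\<lambda>X. of_bool (S \<subseteq> X))"
        unfolding bern_def extinct.simps sum_distrib_left sum.distrib[symmetric] sum_subtractf[symmetric]
        by (intro sum.cong) (auto simp: algebra_simps)
      also have "\<dots> = extinct q k (Suc T) S + a * (1 - q ^ card S)"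
        using Suc.prems by (simp add: bern_const bern_superset algebra_simps del: extinct.simps)
      also have "a * (1 - q ^ card S) \<le> a * \<theta>"
        using True q a unfolding \<theta>_def by (intro mult_left_mono) (auto intro: power_decreasing)
      also have "a * \<theta> \<le> max (\<theta> ^ Suc T) \<eta>"
      proof (cases "\<theta> ^ T \<le> \<eta>")
        case True
        then have "a = \<eta>" by (simp add: a_def)
        moreover have "\<eta> * \<theta> \<le> \<eta> * 1" using \<theta> \<open>\<eta> > 0\<close> by (intro mult_left_mono) auto
        ultimately show ?thesis by simp
      next
        case False
        then show ?thesis by (simp add: a_def max_def mult.commute)
      qed
      finally show ?thesis by (simp del: extinct.simps)
    next
      case False
      have "h S \<le> \<rho> ^ card S" by (rule decay) fact
      also have "\<dots> \<le> \<rho> ^ n" using False \<rho> by (intro power_decreasing) auto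
      finally have "h S \<le> \<eta>" using n by simp
      moreover have "0 \<le> extinct q k (Suc T) S" using q by (intro extinct_nonneg) auto
      ultimately show ?thesis by linarith
    qed
  qed
  obtain T where "\<theta> ^ T < \<eta>"
    using real_arch_pow_inv[OF \<open>\<eta> > 0\<close> \<theta>(2)] by blast
  then have "max (\<theta> ^ T) \<eta> = \<eta>" by simp
  then show ?thesis using step[of _ T] by (intro exI[of _ T]) simp
qed

section \<open>The dual process as percolation in a fixed error field\<close>

text \<open>Here \<open>\<omega>\<close> is the set of space-time points \<open>(i, t)\<close> at which an error occurs, and \<open>dead k \<omega> T i\<close> says
that the dual process started from cell \<open>i\<close> at height \<open>T\<close> is extinct before it reaches height \<open>0\<close>.\<close>
fun dead :: "int \<Rightarrow> (int \<times> int) set \<Rightarrow> nat \<Rightarrow> int \<Rightarrow> bool" where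
  "dead k \<omega> 0 i \<longleftrightarrow> False"
| "dead k \<omega> (Suc T) i \<longleftrightarrow>
     (i, int (Suc T)) \<in> \<omega> \<or> (dead k \<omega> T (i + k) \<and> dead k \<omega> T (i + k + 1))"

lemma dead_cong:
  "(\<And>j t. t \<le> int T \<Longrightarrow> (j, t) \<in> \<omega> \<longleftrightarrow> (j, t) \<in> \<omega>') \<Longrightarrow> dead k \<omega> T i \<longleftrightarrow> dead k \<omega>' T i"
  by (induction T arbitrary: i) auto

lemma offspring_dead:
  "(\<forall>i\<in>offspring k S. P i) \<longleftrightarrow> (\<forall>i\<in>S. P (i + k) \<and> P (i + k + 1))"
  by (auto simp: offspring_def)

lemma bern_image:
  assumes "inj_on f A"
  shows "bern q (f ` A) g = bern q A (\<lambda>X. g (f ` X))"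
  unfolding bern_def
proof (rule sum.reindex_cong[where l = "image f"])
  show "inj_on ((`) f) (Pow A)" using assms by (simp add: inj_on_image_Pow)
  show "Pow (f ` A) = (`) f ` Pow A" by (simp add: image_Pow_surj)
  fix X assume "X \<in> Pow A"
  then show "q ^ card (f ` X) * (1 - q) ^ card (f ` A - f ` X) * g (f ` X)
    = q ^ card X * (1 - q) ^ card (A - X) * g (f ` X)"
    using assms by (auto simp: card_image inj_on_subset inj_on_image_set_diff[symmetric] Diff_subset)
qed

text \<open>The recursion for \<open>extinct\<close> draws fresh errors at every step, and \<open>dead\<close> reads them off one error field.
The two agree because the levels of the field are independent. The statement allows every sufficiently
large box \<open>B\<close>: the subsets \<open>X\<close> of \<open>S\<close> lead to different boxes one level below, and the induction
needs one box that serves all of them.\<close>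
lemma extinct_eq_bern_dead:
  assumes "finite S"
  shows "\<exists>B0. finite B0 \<and> B0 \<subseteq> UNIV \<times> {1..int T} \<and>
    (\<forall>B. finite B \<and> B0 \<subseteq> B \<and> B \<subseteq> UNIV \<times> {1..int T} \<longrightarrow>
       extinct q k T S = bern q B (\<lambda>\<omega>. of_bool (\<forall>i\<in>S. dead k \<omega> T i)))"
  using assms
proof (induction T arbitrary: S)
  case 0
  have "of_bool (S = {}) = (of_bool (\<forall>i\<in>S. dead k \<omega> 0 i) :: real)" for \<omega> by auto
  then show ?case by (intro exI[of _ "{}"]) (auto simp: bern_const)
next
  case (Suc T)
  let ?R = "\<lambda>X. offspring k (S - X)"
  have "\<forall>X\<in>Pow S. \<exists>B0. finite B0 \<and> B0 \<subseteq> UNIV \<times> {1..int T} \<and>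
    (\<forall>B. finite B \<and> B0 \<subseteq> B \<and> B \<subseteq> UNIV \<times> {1..int T} \<longrightarrow>
       extinct q k T (?R X) = bern q B (\<lambda>\<omega>. of_bool (\<forall>i\<in>?R X. dead k \<omega> T i)))"
    using Suc.prems by (intro ballI Suc.IH finite_offspring) auto
  from bchoice[OF this] obtain b where b': "\<forall>X\<in>Pow S. finite (b X) \<and> b X \<subseteq> UNIV \<times> {1..int T} \<and>
    (\<forall>B. finite B \<and> b X \<subseteq> B \<and> B \<subseteq> UNIV \<times> {1..int T} \<longrightarrow>
       extinct q k T (?R X) = bern q B (\<lambda>\<omega>. of_bool (\<forall>i\<in>?R X. dead k \<omega> T i)))"
    by (elim exE)
  have b: "\<And>X. X \<subseteq> S \<Longrightarrow> finite (b X)"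
    "\<And>X. X \<subseteq> S \<Longrightarrow> b X \<subseteq> UNIV \<times> {1..int T}"
    "\<And>X B. X \<subseteq> S \<Longrightarrow> finite B \<Longrightarrow> b X \<subseteq> B \<Longrightarrow> B \<subseteq> UNIV \<times> {1..int T} \<Longrightarrow>
       extinct q k T (?R X) = bern q B (\<lambda>\<omega>. of_bool (\<forall>i\<in>?R X. dead k \<omega> T i))"
    using b' by blast+
  let ?l = "\<lambda>i. (i, int (Suc T))"
  define B0 where "B0 = (\<Union>X\<in>Pow S. b X) \<union> ?l ` S"
  have box: "extinct q k (Suc T) S = bern q B (\<lambda>\<omega>. of_bool (\<forall>i\<in>S. dead k \<omega> (Suc T) i))"
    if B: "finite B" "B0 \<subseteq> B" "B \<subseteq> UNIV \<times> {1..int (Suc T)}" for B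
  proof -
    \<comment> \<open>The box splits into the top-level points above \<open>S\<close>, the remaining top-level
      points \<open>M\<close>, which the event does not involve, and the lower levels \<open>L\<close>.\<close>
    define L where "L = B \<inter> UNIV \<times> {1..int T}"
    define M where "M = B - L - ?l ` S"
    have top: "snd p = int (Suc T)" if "p \<in> M" for p
      using that B(3) by (fastforce simp: M_def L_def)
    have parts: "B = ?l ` S \<union> (M \<union> L)"
      using B(2) by (auto simp: M_def L_def B0_def)
    have fin: "finite L" "finite M" "finite (?l ` S)"
      using B(1) Suc.prems by (auto simp: L_def M_def)
    have bL: "b X \<subseteq> L" if "X \<subseteq> S" for X
      using b(2)[OF that] that B(2) by (auto simp: L_def B0_def)
    have disj: "?l ` S \<inter> (M \<union> L) = {}" "M \<inter> L = {}"
      by (auto simp: M_def L_def)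
    have split_sum: "bern q B g = bern q (?l ` S) (\<lambda>X. bern q M (\<lambda>Y. bern q L (\<lambda>Z. g (X \<union> (Y \<union> Z)))))" for g
    proof -
      have "bern q B g = bern q (?l ` S) (\<lambda>X. bern q (M \<union> L) (\<lambda>Y. g (X \<union> Y)))"
        unfolding parts by (rule bern_union[OF fin(3) finite_UnI[OF fin(2,1)] disj(1)])
      then show ?thesis by (simp only: bern_union[OF fin(2,1) disj(2)])
    qed
    have "bern q B (\<lambda>\<omega>. of_bool (\<forall>i\<in>S. dead k \<omega> (Suc T) i))
      = bern q (?l ` S) (\<lambda>X. bern q M (\<lambda>Y. bern q L (\<lambda>Z.
          of_bool (\<forall>i\<in>S. dead k (X \<union> (Y \<union> Z)) (Suc T) i))))"
      by (rule split_sum)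
    also have "\<dots> = bern q S (\<lambda>X. bern q M (\<lambda>Y. bern q L (\<lambda>Z.
          of_bool (\<forall>i\<in>S. dead k (?l ` X \<union> (Y \<union> Z)) (Suc T) i))))"
      by (rule bern_image) (simp add: inj_on_def)
    also have "\<dots> = bern q S (\<lambda>X. bern q M (\<lambda>Y. bern q L (\<lambda>Z.
          of_bool (\<forall>i\<in>?R X. dead k Z T i))))"
    proof (intro bern_cong arg_cong[where f = of_bool])
      fix X Y Z assume X: "X \<subseteq> S" and Y: "Y \<subseteq> M" and Z: "Z \<subseteq> L"
      have low: "dead k (?l ` X \<union> (Y \<union> Z)) T j \<longleftrightarrow> dead k Z T j" for j
      proof (rule dead_cong)
        fix j' t assume "t \<le> int T"
        then have "(j', t) \<notin> Y" using Y top[of "(j', t)"] by auto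
        with \<open>t \<le> int T\<close> show "(j', t) \<in> ?l ` X \<union> (Y \<union> Z) \<longleftrightarrow> (j', t) \<in> Z" by auto
      qed
      have mem: "?l i \<in> ?l ` X \<union> (Y \<union> Z) \<longleftrightarrow> i \<in> X" if "i \<in> S" for i
        using that Y Z by (auto simp: M_def L_def)
      have "(\<forall>i\<in>S. dead k (?l ` X \<union> (Y \<union> Z)) (Suc T) i)
        \<longleftrightarrow> (\<forall>i\<in>S. i \<in> X \<or> dead k Z T (i + k) \<and> dead k Z T (i + k + 1))"
        by (intro ball_cong refl) (simp only: dead.simps low mem)
      also have "\<dots> \<longleftrightarrow> (\<forall>i\<in>?R X. dead k Z T i)"
        unfolding offspring_dead by blast
      finally show "(\<forall>i\<in>S. dead k (?l ` X \<union> (Y \<union> Z)) (Suc T) i)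
        \<longleftrightarrow> (\<forall>i\<in>?R X. dead k Z T i)" .
    qed
    also have "\<dots> = bern q S (\<lambda>X. extinct q k T (?R X))"
    proof (rule bern_cong)
      fix X assume "X \<subseteq> S"
      then show "bern q M (\<lambda>Y. bern q L (\<lambda>Z. of_bool (\<forall>i\<in>?R X. dead k Z T i))) = extinct q k T (?R X)"
        using b(3)[of X L] bL fin by (simp add: bern_const L_def)
    qed
    finally show ?thesis by simp
  qed
  have "finite B0"
    using Suc.prems b(1) by (auto simp: B0_def)
  moreover have "B0 \<subseteq> UNIV \<times> {1..int (Suc T)}"
    unfolding B0_def
  proof (intro Un_least UN_least)
    fix X assume "X \<in> Pow S"
    then have "b X \<subseteq> UNIV \<times> {1..int T}" using b(2) by simp
    also have "\<dots> \<subseteq> UNIV \<times> {1..int (Suc T)}" by auto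
    finally show "b X \<subseteq> UNIV \<times> {1..int (Suc T)}" .
  qed auto
  ultimately show ?case
    by (intro exI[of _ B0] conjI allI impI box) simp_all
qed

section \<open>Contours and the Peierls bound\<close>

text \<open>A contour is a walk in the space-time plane with three kinds of steps whose vectors add up to zero.
An \<open>Err\<close> step passes over a point of the error field; \<open>Down\<close> and \<open>Up\<close> enter and leave the two
offspring of a point without error.\<close>
datatype step = Err | Down | Up

fun shift :: "int \<Rightarrow> step \<Rightarrow> int \<times> int" where
  "shift k Err = (1, 0)"
| "shift k Down = (k, -1)"
| "shift k Up = (- k - 1, 1)"

fun endpoint :: "int \<Rightarrow> int \<times> int \<Rightarrow> step list \<Rightarrow> int \<times> int" where
  "endpoint k v [] = v"
| "endpoint k v (s # w) = endpoint k (v + shift k s) w"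

fun err_sites :: "int \<Rightarrow> int \<times> int \<Rightarrow> step list \<Rightarrow> (int \<times> int) list" where
  "err_sites k v [] = []"
| "err_sites k v (s # w) = (if s = Err then [v] else []) @ err_sites k (v + shift k s) w"

lemma endpoint_append [simp]: "endpoint k v (w @ w') = endpoint k (endpoint k v w) w'"
  by (induction w arbitrary: v) auto

lemma err_sites_append [simp]:
  "err_sites k v (w @ w') = err_sites k v w @ err_sites k (endpoint k v w) w'"
  by (induction w arbitrary: v) auto

lemma endpoint_eq:
  "endpoint k v w = (fst v + int (count_list w Err) + k * int (count_list w Down)
      - (k + 1) * int (count_list w Up),
    snd v - int (count_list w Down) + int (count_list w Up))"
proof (induction w arbitrary: v)
  case (Cons s w)
  then show ?case by (cases s) (auto simp: algebra_simps)
qed simp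

lemma length_err_sites: "length (err_sites k v w) = count_list w Err"
  by (induction w arbitrary: v) auto

lemma length_word: "length w = count_list w Err + count_list w Down + count_list w Up"
proof (induction w)
  case (Cons s w)
  then show ?case by (cases s) auto
qed simp

text \<open>The three step vectors sum to zero and any two of them are linearly independent. A walk across one cell
therefore uses \<open>m\<close> error steps, \<open>m - 1\<close> down steps and \<open>m - 1\<close> up steps. Hence there are at most
\<open>3 ^ (3 * m) = 27 ^ m\<close> such walks with \<open>m\<close> errors, which is the origin of the number 27.\<close>
lemma length_word_cell:
  assumes "endpoint k (i, t) w = (i + 1, t)"
  shows "length w + 2 = 3 * length (err_sites k (i, t) w)"
proof -
  have eq: "count_list w Down = count_list w Up"
    using assms by (simp add: endpoint_eq)
  moreover from this have "count_list w Err = count_list w Up + 1"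
    using assms by (simp add: endpoint_eq algebra_simps)
  ultimately show ?thesis by (simp add: length_err_sites length_word)
qed

text \<open>A point of extinction is either an error, crossed by a single \<open>Err\<close> step, or both of its offspring
are points of extinction and the walk descends, crosses them one after the other and climbs back.\<close>
lemma dead_imp_word:
  assumes "dead k \<omega> T i"
  shows "\<exists>w. endpoint k (i, int T) w = (i + 1, int T) \<and> set (err_sites k (i, int T) w) \<subseteq> \<omega>"
  using assms
proof (induction T arbitrary: i)
  case (Suc T)
  show ?case
  proof (cases "(i, int (Suc T)) \<in> \<omega>")
    case True
    then show ?thesis by (intro exI[of _ "[Err]"]) simp
  next
    case False
    with Suc.prems have "dead k \<omega> T (i + k)" "dead k \<omega> T (i + k + 1)" by auto
    then obtain w w' where
      "endpoint k (i + k, int T) w = (i + k + 1, int T)" "set (err_sites k (i + k, int T) w) \<subseteq> \<omega>"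
      "endpoint k (i + k + 1, int T) w' = (i + k + 2, int T)"
      "set (err_sites k (i + k + 1, int T) w') \<subseteq> \<omega>"
      using Suc.IH[of "i + k"] Suc.IH[of "i + k + 1"] by (auto simp: add.assoc)
    then show ?thesis by (intro exI[of _ "Down # w @ w' @ [Up]"]) simp
  qed
qed simp

lemma err_sites_split:
  assumes "err_sites k v w = xs @ [p] @ ys"
  shows "\<exists>a b. w = a @ Err # b \<and> endpoint k v a = p \<and> err_sites k v a = xs
    \<and> err_sites k (p + (1, 0)) b = ys"
  using assms
proof (induction w arbitrary: v xs)
  case (Cons s w)
  show ?case
  proof (cases "s = Err \<and> xs = []")
    case True
    with Cons.prems show ?thesis by (rule_tac exI[of _ "[]"], rule_tac exI[of _ w]) simp
  next
    case False
    define xs' where "xs' = (if s = Err then tl xs else xs)"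
    have xs: "xs = (if s = Err then [v] else []) @ xs'"
      using False Cons.prems by (cases xs) (auto simp: xs'_def)
    then have "err_sites k (v + shift k s) w = xs' @ [p] @ ys"
      using Cons.prems by simp
    from Cons.IH[OF this] obtain a b where "w = a @ Err # b" "endpoint k (v + shift k s) a = p"
      "err_sites k (v + shift k s) a = xs'" "err_sites k (p + (1, 0)) b = ys" by blast
    then show ?thesis using xs by (intro exI[of _ "s # a"] exI[of _ b]) simp
  qed
qed simp

text \<open>The walk of \<open>dead_imp_word\<close> may meet one error several times, since the offspring of neighboring cells
overlap. In a shortest walk this cannot happen: if an error is met twice, the loop between the two
visits can be cut out. Distinct errors are independent, as the union bound requires.\<close>
lemma dead_imp_distinct_word:
  assumes "dead k \<omega> T i"
  shows "\<exists>w. endpoint k (i, int T) w = (i + 1, int T) \<and> set (err_sites k (i, int T) w) \<subseteq> \<omega>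
    \<and> distinct (err_sites k (i, int T) w)"
proof -
  let ?v = "(i, int T)"
  let ?P = "\<lambda>w. endpoint k ?v w = (i + 1, int T) \<and> set (err_sites k ?v w) \<subseteq> \<omega>"
  obtain w where w: "?P w" and min: "\<And>w'. ?P w' \<Longrightarrow> length w \<le> length w'"
    using ex_has_least_nat[of ?P _ length] dead_imp_word[OF assms] by blast
  have "distinct (err_sites k ?v w)"
  proof (rule ccontr)
    assume "\<not> distinct (err_sites k ?v w)"
    then obtain xs ys zs p where dec: "err_sites k ?v w = xs @ [p] @ ys @ [p] @ zs"
      by (auto dest: not_distinct_decomp)
    obtain a b where a: "w = a @ Err # b" "endpoint k ?v a = p" "err_sites k ?v a = xs"
      and b: "err_sites k (p + (1, 0)) b = ys @ [p] @ zs"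
      using err_sites_split[OF dec] by blast
    obtain c d where c: "b = c @ Err # d" "endpoint k (p + (1, 0)) c = p"
      "err_sites k (p + (1, 0)) d = zs"
      using err_sites_split[OF b] by blast
    have "?P (a @ Err # d)"
      using w a c dec by auto
    from min[OF this] show False using a(1) c(1) by simp
  qed
  with w show ?thesis by blast
qed

lemma card_step_words: "card {w :: step list. length w = n} = 3 ^ n"
proof -
  have U: "(UNIV :: step set) = {Err, Down, Up}" by (auto intro: step.exhaust)
  have "card {w. set w \<subseteq> (UNIV :: step set) \<and> length w = n} = card (UNIV :: step set) ^ n"
    by (rule card_lists_length_eq) (simp add: U)
  moreover have "card (UNIV :: step set) = 3" by (simp add: U)
  ultimately show ?thesis by simp
qed

lemma finite_step_words: "finite {w :: step list. length w = n}"
  using card_step_words[of n] by (intro card_ge_0_finite) simp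

text \<open>Peierls argument: the union bound over all contours, ordered by their number \<open>m\<close> of errors, bounds
extinction by the geometric series with ratio \<open>27 * q\<close>.\<close>
lemma extinct_singleton_le:
  assumes q: "0 < q" "27 * q < 1"
  shows "extinct q k T {i} \<le> 27 * q / (1 - 27 * q)"
proof -
  obtain B where B: "finite B"
    and eq: "extinct q k T {i} = bern q B (\<lambda>\<omega>. of_bool (\<forall>j\<in>{i}. dead k \<omega> T j))"
    using extinct_eq_bern_dead[of "{i}" T q k] by blast
  let ?E = "\<lambda>w. err_sites k (i, int T) w"
  define W where "W m = {w. length w = 3 * m - 2 \<and> length (?E w) = m \<and> distinct (?E w)}" for m
  have finW: "finite (W m)" for m
    by (rule finite_subset[OF _ finite_step_words[of "3 * m - 2"]]) (auto simp: W_def)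
  have cardW: "card (W m) \<le> 27 ^ m" for m
  proof -
    have "card (W m) \<le> card {w :: step list. length w = 3 * m - 2}"
      by (intro card_mono finite_step_words) (auto simp: W_def)
    also have "\<dots> \<le> 3 ^ (3 * m)"
      unfolding card_step_words by (intro power_increasing) auto
    finally show ?thesis by (simp add: power_mult)
  qed
  have "extinct q k T {i} \<le> bern q B (\<lambda>\<omega>. \<Sum>m\<in>{1..card B}. \<Sum>w\<in>W m. of_bool (set (?E w) \<subseteq> \<omega>))"
    unfolding eq
  proof (rule bern_mono)
    fix \<omega> assume \<omega>: "\<omega> \<subseteq> B"
    show "of_bool (\<forall>j\<in>{i}. dead k \<omega> T j)
      \<le> (\<Sum>m\<in>{1..card B}. \<Sum>w\<in>W m. of_bool (set (?E w) \<subseteq> \<omega>) :: real)"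
    proof (cases "dead k \<omega> T i")
      case True
      then obtain w where w: "endpoint k (i, int T) w = (i + 1, int T)"
        "set (?E w) \<subseteq> \<omega>" "distinct (?E w)"
        using dead_imp_distinct_word by blast
      define m where "m = length (?E w)"
      have len: "length w + 2 = 3 * m"
        using length_word_cell[OF w(1)] by (simp add: m_def)
      have "m = card (set (?E w))" using w(3) by (simp add: m_def distinct_card)
      also have "\<dots> \<le> card B" using w(2) \<omega> B by (intro card_mono) auto
      finally have m: "m \<in> {1..card B}" using len by auto
      have wW: "w \<in> W m" using len w(3) by (auto simp: W_def m_def)
      have "1 = (of_bool (set (?E w) \<subseteq> \<omega>) :: real)" using w(2) by simp
      also have "\<dots> \<le> (\<Sum>w\<in>W m. of_bool (set (?E w) \<subseteq> \<omega>))"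
        using wW finW by (intro member_le_sum) auto
      also have "\<dots> \<le> (\<Sum>m\<in>{1..card B}. \<Sum>w\<in>W m. of_bool (set (?E w) \<subseteq> \<omega>))"
        using m by (intro member_le_sum) (auto intro: sum_nonneg)
      finally show ?thesis using True by simp
    qed (auto intro!: sum_nonneg)
  qed (use q in auto)
  also have "\<dots> = (\<Sum>m\<in>{1..card B}. \<Sum>w\<in>W m. bern q B (\<lambda>\<omega>. of_bool (set (?E w) \<subseteq> \<omega>)))"
    by (simp add: bern_sum)
  also have "\<dots> \<le> (\<Sum>m\<in>{1..card B}. \<Sum>w\<in>W m. q ^ m)"
    using q B by (intro sum_mono) (auto simp: bern_superset W_def distinct_card)
  also have "\<dots> \<le> (\<Sum>m\<in>{1..card B}. (27 * q) ^ m)"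
  proof (intro sum_mono)
    fix m
    have "real (card (W m)) * q ^ m \<le> real (27 ^ m) * q ^ m"
      using cardW[of m] q by (intro mult_right_mono) (auto simp del: of_nat_power)
    then show "(\<Sum>w\<in>W m. q ^ m) \<le> (27 * q) ^ m" by (simp add: power_mult_distrib)
  qed
  also have "\<dots> = ((27 * q) - (27 * q) ^ Suc (card B)) / (1 - 27 * q)"
    unfolding sum_gp using q by (cases "card B") auto
  also have "\<dots> \<le> 27 * q / (1 - 27 * q)"
    using q by (intro divide_right_mono) auto
  finally show ?thesis .
qed

section \<open>Probabilistic cellular automata and invariant measures\<close>

lemma disjoint_cylinders:
  assumes "P \<subseteq> A \<rightarrow>\<^sub>E UNIV"
  shows "disjoint_family_on (cylinder A) P"
  unfolding disjoint_family_on_def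
proof (intro ballI impI equals0I)
  fix u v y assume uv: "u \<in> P" "v \<in> P" "u \<noteq> v" and y: "y \<in> cylinder A u \<inter> cylinder A v"
  have "u = v"
  proof (rule PiE_ext)
    show "u \<in> A \<rightarrow>\<^sub>E UNIV" "v \<in> A \<rightarrow>\<^sub>E UNIV" using uv assms by blast+
    show "u i = v i" if "i \<in> A" for i
    proof -
      have "y i = u i" "y i = v i" using y that by (auto simp: cylinder_def)
      then show ?thesis by simp
    qed
  qed
  with \<open>u \<noteq> v\<close> show False by contradiction
qed

lemma PCA_block_prob:
  fixes \<phi> :: "'a::finite config \<Rightarrow> 'a \<Rightarrow> real"
  assumes PCA: "is_PCA N \<phi> \<Phi>" and "finite S"
  shows "{y. \<forall>i\<in>S. y i \<in> B} \<in> sets configs"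
    and "measure (\<Phi> x) {y. \<forall>i\<in>S. y i \<in> B} = (\<Prod>i\<in>S. \<Sum>a\<in>B. \<phi> (window N x i) a)"
proof -
  have eq: "{y. \<forall>i\<in>S. y i \<in> B} = (\<Union>u\<in>S \<rightarrow>\<^sub>E B. cylinder S u)"
  proof (intro equalityI subsetI)
    fix y assume "y \<in> {y. \<forall>i\<in>S. y i \<in> B}"
    then show "y \<in> (\<Union>u\<in>S \<rightarrow>\<^sub>E B. cylinder S u)"
      by (intro UN_I[of "restrict y S"]) (auto simp: cylinder_def)
  qed (auto simp: cylinder_def dest: PiE_mem)
  have fin: "finite (S \<rightarrow>\<^sub>E B)" using \<open>finite S\<close> by (intro finite_PiE) auto
  show "{y. \<forall>i\<in>S. y i \<in> B} \<in> sets configs"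
    unfolding eq using fin \<open>finite S\<close> by (intro sets.finite_UN cylinder_in_sets)
  have "\<Phi> x \<in> space (prob_algebra configs)"
    using PCA by (intro measurable_space[of \<Phi> configs]) (auto simp: is_PCA_def space_configs)
  then have px: "prob_space (\<Phi> x)" "sets (\<Phi> x) = sets configs"
    by (auto simp: space_prob_algebra)
  interpret prob_space "\<Phi> x" by fact
  have "measure (\<Phi> x) {y. \<forall>i\<in>S. y i \<in> B} = (\<Sum>u\<in>S \<rightarrow>\<^sub>E B. measure (\<Phi> x) (cylinder S u))"
    unfolding eq
  proof (rule finite_measure_finite_Union[OF fin])
    show "disjoint_family_on (cylinder S) (S \<rightarrow>\<^sub>E B)"
      by (rule disjoint_cylinders) auto
  qed (auto simp: px(2) \<open>finite S\<close> cylinder_in_sets)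
  also have "\<dots> = (\<Sum>u\<in>S \<rightarrow>\<^sub>E B. \<Prod>i\<in>S. \<phi> (window N x i) (u i))"
  proof (intro sum.cong refl)
    fix u assume "u \<in> S \<rightarrow>\<^sub>E B"
    then have "u \<in> S \<rightarrow>\<^sub>E UNIV" by (auto simp: PiE_iff)
    then show "measure (\<Phi> x) (cylinder S u) = (\<Prod>i\<in>S. \<phi> (window N x i) (u i))"
      using PCA \<open>finite S\<close> by (auto simp: is_PCA_def)
  qed
  also have "\<dots> = (\<Prod>i\<in>S. \<Sum>a\<in>B. \<phi> (window N x i) a)"
    using \<open>finite S\<close> by (intro prod_sum_PiE[symmetric]) auto
  finally show "measure (\<Phi> x) {y. \<forall>i\<in>S. y i \<in> B} = (\<Prod>i\<in>S. \<Sum>a\<in>B. \<phi> (window N x i) a)" .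
qed

lemma invariant_measure_eq:
  assumes inv: "invariant_prob \<Phi> \<mu>" and \<Phi>: "\<Phi> \<in> configs \<rightarrow>\<^sub>M prob_algebra configs"
    and B: "B \<in> sets configs"
  shows "measure \<mu> B = (\<integral>x. measure (\<Phi> x) B \<partial>\<mu>)" and "integrable \<mu> (\<lambda>x. measure (\<Phi> x) B)"
proof -
  have \<mu>: "prob_space \<mu>" "sets \<mu> = sets configs" "\<mu> \<bind> \<Phi> = \<mu>"
    using inv by (auto simp: invariant_prob_def config_prob_def)
  interpret prob_space \<mu> by fact
  have m: "\<Phi> \<in> \<mu> \<rightarrow>\<^sub>M subprob_algebra configs"
    using \<Phi> \<mu>(2) by (metis measurable_cong_sets measurable_prob_algebraD)
  show "measure \<mu> B = (\<integral>x. measure (\<Phi> x) B \<partial>\<mu>)"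
    using measure_bind[OF m B] \<mu>(3) by simp
  show "integrable \<mu> (\<lambda>x. measure (\<Phi> x) B)"
  proof (rule integrable_const_bound[where B = 1])
    show "(\<lambda>x. measure (\<Phi> x) B) \<in> borel_measurable \<mu>"
      using measure_measurable_subprob_algebra2[OF _ m, of "\<lambda>_. B"] B by (simp add: pair_measureI)
    show "AE x in \<mu>. norm (measure (\<Phi> x) B) \<le> 1"
    proof (rule AE_I2)
      fix x assume "x \<in> space \<mu>"
      then have "\<Phi> x \<in> space (subprob_algebra configs)" using m by (rule measurable_space[rotated])
      then interpret subprob_space "\<Phi> x" by (simp add: space_subprob_algebra)
      show "norm (measure (\<Phi> x) B) \<le> 1" using subprob_measure_le_1 by simp
    qed
  qed
qed

section \<open>Invariant measures of a perturbed automaton with a spreading state\<close>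

locale perturbed_spreading_CA =
  fixes z :: "'a::finite" and N :: "int set" and k :: int and r :: nat
    and f :: "'a config \<Rightarrow> 'a" and F :: "'a config \<Rightarrow> 'a config"
    and \<epsilon> :: real and \<phi> :: "'a config \<Rightarrow> 'a \<Rightarrow> real"
    and \<Phi> :: "'a config \<Rightarrow> 'a config measure" and \<pi> :: "'a config measure"
  assumes N: "N = {k..<k + int r}" and r: "2 \<le> r"
    and CA: "is_CA N f F"
    and spreading: "spreading_state N F z"
    and eps: "0 < \<epsilon>" "27 * \<epsilon> < 1"
    and PCA: "is_PCA N \<phi> \<Phi>"
    and perturbation: "eps_perturbation \<epsilon> N f \<phi>"
    and positive: "state_positive N z \<phi>"
    and invariant: "invariant_prob \<Phi> \<pi>"
begin

sublocale prob_space \<pi>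
  using invariant by (simp add: invariant_prob_def config_prob_def)

lemma sets_\<pi>: "sets \<pi> = sets configs"
  using invariant by (simp add: invariant_prob_def config_prob_def)

lemma space_\<pi>: "space \<pi> = UNIV"
  using sets_eq_imp_space_eq[OF sets_\<pi>] by (simp add: space_configs)

lemma kernel: "\<Phi> \<in> configs \<rightarrow>\<^sub>M prob_algebra configs"
  using PCA by (simp add: is_PCA_def)

lemma window_pattern: "window N x i \<in> N \<rightarrow>\<^sub>E UNIV"
  by (simp add: window_def)

lemma rule_prob: "0 \<le> \<phi> (window N x i) a" "(\<Sum>a\<in>UNIV. \<phi> (window N x i) a) = 1"
  using PCA window_pattern[of x i] by (auto simp: is_PCA_def stochastic_rule_def)

lemma rule_not_z: "(\<Sum>a\<in>-{z}. \<phi> (window N x i) a) = 1 - \<phi> (window N x i) z"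
  using rule_prob(2)[of x i] by (simp add: sum.remove[of UNIV z] Compl_eq_Diff_UNIV)

lemma rule_z_ge:
  assumes "j \<in> N" "x (i + j) = z"
  shows "1 - \<epsilon> \<le> \<phi> (window N x i) z"
proof -
  have "f (window N x i) = z"
    using CA spreading assms by (auto simp: is_CA_def spreading_state_def)
  then show ?thesis
    using perturbation window_pattern[of x i] by (auto simp: eps_perturbation_def)
qed

lemma rule_z_le: "\<phi> (window N x i) z \<le> 1"
  using rule_not_z[of x i] sum_nonneg[of "-{z}" "\<phi> (window N x i)"] rule_prob(1)[of x i] by simp

definition no_z :: "int set \<Rightarrow> 'a config set" where
  "no_z S = {y. \<forall>i\<in>S. y i \<in> - {z}}"

definition all_z :: "int set \<Rightarrow> 'a config set" where
  "all_z S = {y. \<forall>i\<in>S. y i \<in> {z}}"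

lemma no_z_sets: "finite S \<Longrightarrow> no_z S \<in> sets configs"
  unfolding no_z_def by (rule PCA_block_prob(1)[OF PCA])

lemma all_z_sets: "finite S \<Longrightarrow> all_z S \<in> sets configs"
  unfolding all_z_def by (rule PCA_block_prob(1)[OF PCA])

lemma kernel_no_z:
  "finite S \<Longrightarrow> measure (\<Phi> x) (no_z S) = (\<Prod>i\<in>S. 1 - \<phi> (window N x i) z)"
  unfolding no_z_def by (simp only: PCA_block_prob(2)[OF PCA] rule_not_z)

lemma kernel_all_z: "finite S \<Longrightarrow> measure (\<Phi> x) (all_z S) = (\<Prod>i\<in>S. \<phi> (window N x i) z)"
  using PCA_block_prob(2)[OF PCA, of S x "{z}"] by (simp add: all_z_def)

text \<open>By invariance, \<open>\<pi>\<close> may be replaced by its image under the kernel. Given the previous configuration, a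
cell avoids \<open>z\<close> with probability at most \<open>\<epsilon>\<close>, unless both its offspring avoid \<open>z\<close>; and the cells are
updated independently.\<close>
lemma prob_no_z_subharmonic:
  assumes "finite S"
  shows "prob (no_z S) \<le> bern \<epsilon> S (\<lambda>X. prob (no_z (offspring k (S - X))))"
proof -
  let ?free = "\<lambda>x i. x (i + k) \<noteq> z \<and> x (i + k + 1) \<noteq> z"
  let ?I = "\<lambda>X. indicator (no_z (offspring k (S - X))) :: 'a config \<Rightarrow> real"
  have meas: "no_z (offspring k (S - X)) \<in> sets \<pi>" for X
    using assms by (simp add: sets_\<pi> no_z_sets finite_offspring)
  have integrable: "integrable \<pi> (?I X)" for X
    using meas by (intro integrable_real_indicator) (auto simp: emeasure_eq_measure)
  have "measure (\<Phi> x) (no_z S) \<le> bern \<epsilon> S (\<lambda>X. ?I X x)" for x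
  proof -
    have "measure (\<Phi> x) (no_z S) \<le> (\<Prod>i\<in>S. \<epsilon> + (1 - \<epsilon>) * of_bool (?free x i))"
      unfolding kernel_no_z[OF assms]
    proof (rule prod_mono)
      fix i
      have "k \<in> N" "k + 1 \<in> N" using N r by auto
      then show "0 \<le> 1 - \<phi> (window N x i) z
          \<and> 1 - \<phi> (window N x i) z \<le> \<epsilon> + (1 - \<epsilon>) * of_bool (?free x i)"
        using rule_z_ge[of k x i] rule_z_ge[of "k + 1" x i] rule_z_le[of x i] rule_prob(1)[of x i z]
        by (auto simp: add.assoc)
    qed
    also have "\<dots> = bern \<epsilon> S (\<lambda>X. \<Prod>i\<in>S - X. of_bool (?free x i))"
      by (rule bern_prod[OF assms, symmetric])
    also have "\<dots> = bern \<epsilon> S (\<lambda>X. ?I X x)"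
    proof (rule bern_cong)
      fix X
      show "(\<Prod>i\<in>S - X. of_bool (?free x i)) = ?I X x"
        using assms by (auto simp: no_z_def offspring_dead indicator_def prod_zero_iff)
    qed
    finally show ?thesis .
  qed
  then have "prob (no_z S) \<le> (\<integral>x. bern \<epsilon> S (\<lambda>X. ?I X x) \<partial>\<pi>)"
    unfolding invariant_measure_eq(1)[OF invariant kernel no_z_sets[OF assms]]
    by (intro integral_mono invariant_measure_eq(2)[OF invariant kernel no_z_sets[OF assms]])
       (auto simp: bern_def intro!: Bochner_Integration.integrable_sum integrable)
  also have "\<dots> = bern \<epsilon> S (\<lambda>X. prob (no_z (offspring k (S - X))))"
    unfolding bern_def
    by (subst Bochner_Integration.integral_sum) (auto intro: integrable simp: space_\<pi>)
  finally show ?thesis .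
qed

text \<open>Positivity enters here: there are finitely many patterns, so every cell becomes \<open>z\<close> with a probability
that is bounded away from zero, whatever the previous configuration.\<close>
lemma prob_no_z_decay:
  obtains \<rho> where "0 \<le> \<rho>" "\<rho> < 1" "\<And>S. finite S \<Longrightarrow> prob (no_z S) \<le> \<rho> ^ card S"
proof
  let ?P = "N \<rightarrow>\<^sub>E (UNIV :: 'a set)"
  define \<delta> where "\<delta> = Min ((\<lambda>p. \<phi> p z) ` ?P)"
  have finP: "finite ?P" using N by (intro finite_PiE) auto
  have neP: "?P \<noteq> {}" using window_pattern[of undefined 0] by (rule ex_in_conv[THEN iffD1, OF exI])
  have \<delta>: "0 < \<delta>"
    unfolding \<delta>_def using finP neP positive by (subst Min_gr_iff) (auto simp: state_positive_def)
  have \<delta>_le: "\<delta> \<le> \<phi> (window N x i) z" for x i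
    unfolding \<delta>_def using finP
    by (intro Min_le finite_imageI image_eqI[of _ _ "window N x i"] window_pattern refl)
  show "0 \<le> 1 - \<delta>" using order_trans[OF \<delta>_le rule_z_le] by simp
  show "1 - \<delta> < 1" using \<delta> by simp
  fix S :: "int set" assume S: "finite S"
  have "measure (\<Phi> x) (no_z S) \<le> (1 - \<delta>) ^ card S" for x
    unfolding kernel_no_z[OF S] prod_constant[symmetric]
    using \<delta>_le rule_z_le by (intro prod_mono) auto
  then have "prob (no_z S) \<le> (\<integral>x. (1 - \<delta>) ^ card S \<partial>\<pi>)"
    unfolding invariant_measure_eq(1)[OF invariant kernel no_z_sets[OF S]]
    by (intro integral_mono invariant_measure_eq(2)[OF invariant kernel no_z_sets[OF S]]) auto
  then show "prob (no_z S) \<le> (1 - \<delta>) ^ card S" by (simp add: prob_space)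
qed

lemma prob_cell_not_z: "prob (no_z {i}) \<le> 27 * \<epsilon> / (1 - 27 * \<epsilon>)"
proof (rule field_le_epsilon)
  fix \<eta> :: real assume "0 < \<eta>"
  obtain \<rho> where \<rho>: "0 \<le> \<rho>" "\<rho> < 1" "\<And>S. finite S \<Longrightarrow> prob (no_z S) \<le> \<rho> ^ card S"
    using prob_no_z_decay by blast
  have "\<epsilon> \<le> 1" using eps by simp
  have "\<exists>T. \<forall>S. finite S \<longrightarrow> prob (no_z S) \<le> extinct \<epsilon> k T S + \<eta>"
    by (rule subharmonic_le_extinct[OF eps(1) \<open>\<epsilon> \<le> 1\<close> \<rho>(1,2) \<open>0 < \<eta>\<close>])
       (rule prob_no_z_subharmonic \<rho>(3), assumption)+
  then obtain T where "\<forall>S. finite S \<longrightarrow> prob (no_z S) \<le> extinct \<epsilon> k T S + \<eta>" by (elim exE)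
  then have "prob (no_z {i}) \<le> extinct \<epsilon> k T {i} + \<eta>" by simp
  then show "prob (no_z {i}) \<le> 27 * \<epsilon> / (1 - 27 * \<epsilon>) + \<eta>"
    using extinct_singleton_le[OF eps, of k T i] by linarith
qed

lemma prob_cell_z: "1 - 27 * \<epsilon> / (1 - 27 * \<epsilon>) \<le> prob (all_z {i})"
proof -
  have "all_z {i} = space \<pi> - no_z {i}"
    by (auto simp: all_z_def no_z_def space_\<pi>)
  then show ?thesis
    using prob_cell_not_z[of i] prob_compl[of "no_z {i}"] by (simp add: sets_\<pi> no_z_sets)
qed

text \<open>If every cell of \<open>S'\<close> sees a cell of \<open>S\<close>, then \<open>z\<close> spreads from \<open>S\<close> to the whole of \<open>S'\<close> in one step,
unless an error occurs in \<open>S'\<close>.\<close>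
lemma prob_all_z_step:
  assumes "finite S" "finite S'" and reach: "\<And>i. i \<in> S' \<Longrightarrow> \<exists>j\<in>N. i + j \<in> S"
  shows "(1 - \<epsilon>) ^ card S' * prob (all_z S) \<le> prob (all_z S')"
proof -
  have meas: "all_z S \<in> sets \<pi>" using assms by (simp add: sets_\<pi> all_z_sets)
  have integrable: "integrable \<pi> (indicator (all_z S) :: _ \<Rightarrow> real)"
    using meas by (intro integrable_real_indicator) (auto simp: emeasure_eq_measure)
  have "(1 - \<epsilon>) ^ card S' * indicator (all_z S) x \<le> measure (\<Phi> x) (all_z S')" for x
  proof (cases "x \<in> all_z S")
    case True
    have "(\<Prod>i\<in>S'. 1 - \<epsilon>) \<le> (\<Prod>i\<in>S'. \<phi> (window N x i) z)"
    proof (rule prod_mono)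
      fix i assume "i \<in> S'"
      with reach obtain j where "j \<in> N" "i + j \<in> S" by blast
      then show "0 \<le> 1 - \<epsilon> \<and> 1 - \<epsilon> \<le> \<phi> (window N x i) z"
        using True eps rule_z_ge[of j x i] by (auto simp: all_z_def)
    qed
    then show ?thesis using True by (simp add: kernel_all_z[OF assms(2)])
  qed simp
  then have "(\<integral>x. (1 - \<epsilon>) ^ card S' * indicator (all_z S) x \<partial>\<pi>) \<le> prob (all_z S')"
    unfolding invariant_measure_eq(1)[OF invariant kernel all_z_sets[OF assms(2)]]
    using integrable by (intro integral_mono invariant_measure_eq(2)[OF invariant kernel all_z_sets[OF assms(2)]]) auto
  then show ?thesis using meas by simp
qed

text \<open>The cells that a single cell \<open>c\<close> influences after \<open>s\<close> steps of the automaton.\<close>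
definition cone :: "int \<Rightarrow> nat \<Rightarrow> int set" where
  "cone c s = {c - int s * (k + int r - 1)..c - int s * k}"

lemma card_cone: "card (cone c s) = 1 + s * (r - 1)"
proof -
  have "int (r - 1) = int r - 1" using r by simp
  then have "c - int s * k - (c - int s * (k + int r - 1)) + 1 = int (1 + s * (r - 1))"
    by (simp add: algebra_simps)
  then show ?thesis unfolding cone_def card_atLeastAtMost_int by (simp only: nat_int)
qed

lemma prob_all_z_cone:
  "(1 - \<epsilon>) ^ (\<Sum>s=1..t. 1 + s * (r - 1)) * (1 - 27 * \<epsilon> / (1 - 27 * \<epsilon>)) \<le> prob (all_z (cone c t))"
proof (induction t)
  case 0
  show ?case using prob_cell_z[of c] by (simp add: cone_def)
next
  case (Suc t)
  let ?n = "1 + Suc t * (r - 1)"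
  have "(1 - \<epsilon>) ^ ?n * prob (all_z (cone c t)) \<le> prob (all_z (cone c (Suc t)))"
    unfolding card_cone[of c, symmetric]
  proof (rule prob_all_z_step)
    fix i assume i: "i \<in> cone c (Suc t)"
    define lo where "lo = c - int t * (k + int r - 1)"
    have hi: "lo \<le> c - int t * k"
      using r mult_left_mono[of k "k + int r - 1" "int t"] by (simp add: lo_def)
    have i': "lo - (k + int r - 1) \<le> i" "i \<le> (c - int t * k) - k"
      using i by (auto simp: cone_def lo_def algebra_simps)
    show "\<exists>j\<in>N. i + j \<in> cone c t"
    \<comment> \<open>If the left end \<open>i + k\<close> of the window lies to the left of the previous interval, then
      its left end \<open>lo\<close> is in the window; otherwise \<open>i + k\<close> is in that interval.\<close>
    proof (cases "i + k \<ge> lo")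
      case True
      then show ?thesis using i' r by (intro bexI[of _ k]) (auto simp: cone_def N lo_def[symmetric])
    next
      case False
      then show ?thesis using i' hi
        by (intro bexI[of _ "lo - i"]) (auto simp: cone_def N lo_def[symmetric])
    qed
  qed (auto simp: cone_def)
  moreover have "(1 - \<epsilon>) ^ ?n * ((1 - \<epsilon>) ^ (\<Sum>s=1..t. 1 + s * (r - 1)) * (1 - 27 * \<epsilon> / (1 - 27 * \<epsilon>)))
      \<le> (1 - \<epsilon>) ^ ?n * prob (all_z (cone c t))"
    using eps Suc.IH by (intro mult_left_mono) auto
  moreover have "(\<Sum>s=1..Suc t. 1 + s * (r - 1)) = (\<Sum>s=1..t. 1 + s * (r - 1)) + ?n"
    by simp
  ultimately show ?case by (simp only: power_add mult.assoc mult.left_commute)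
qed

text \<open>For \<open>r \<ge> 2\<close> the cone gains at least one cell per step, so after \<open>card {a..b}\<close> steps from a suitable apex
it covers the interval. The exponent is the number of space-time points of this truncated cone below
its apex: no error may occur at any of them.\<close>
lemma prob_all_z_interval:
  "(1 - \<epsilon>) ^ (\<Sum>s=1..card {a..b}. 1 + s * (r - 1)) * (1 - 27 * \<epsilon> / (1 - 27 * \<epsilon>))
     \<le> prob (all_z {a..b})"
proof -
  define n where "n = card {a..b}"
  define c where "c = a + int n * (k + int r - 1)"
  have "int n * 1 \<le> int n * (int r - 1)" using r by (intro mult_left_mono) auto
  then have "a + int n \<le> c - int n * k" by (simp add: c_def algebra_simps)
  moreover have "b \<le> a + int n" by (simp add: n_def)
  ultimately have "{a..b} \<subseteq> cone c n" by (auto simp: cone_def c_def)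
  then have "all_z (cone c n) \<subseteq> all_z {a..b}" by (auto simp: all_z_def)
  then have "prob (all_z (cone c n)) \<le> prob (all_z {a..b})"
    by (intro finite_measure_mono) (auto simp: sets_\<pi> all_z_sets)
  then show ?thesis using prob_all_z_cone[of n c] by (simp add: n_def)
qed

text \<open>The Dirac measure charges a single cylinder over \<open>A\<close>. There it exceeds \<open>\<pi>\<close> by the total mass that \<open>\<pi>\<close>
gives to all the others, so the two contributions to the distance are equal.\<close>
lemma tv_on_dirac_const:
  assumes "finite A"
  shows "tv_on A (dirac_const z) \<pi> = 1 - prob (all_z A)"
proof -
  let ?P = "A \<rightarrow>\<^sub>E (UNIV :: 'a set)"
  define u0 where "u0 = (\<lambda>i\<in>A. z)"
  have u0: "u0 \<in> ?P" by (simp add: u0_def)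
  have finP: "finite ?P" using assms by (intro finite_PiE) auto
  have all_z: "cylinder A u0 = all_z A" by (auto simp: cylinder_def all_z_def u0_def)
  have meas: "cylinder A u \<in> sets \<pi>" for u using assms by (simp add: sets_\<pi> cylinder_in_sets)
  have dirac: "measure (dirac_const z) (cylinder A u) = of_bool (u = u0)" if "u \<in> ?P" for u
  proof -
    have "(\<lambda>_. z) \<in> cylinder A u \<longleftrightarrow> u = u0"
      using that by (auto simp: cylinder_def u0_def PiE_iff extensional_def)
    then show ?thesis
      using assms by (auto simp: dirac_const_def measure_return cylinder_in_sets indicator_def)
  qed
  have "(\<Sum>u\<in>?P. prob (cylinder A u)) = prob (\<Union>u\<in>?P. cylinder A u)"
    using finP meas
    by (intro finite_measure_finite_Union[symmetric] disjoint_cylinders) auto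
  also have "(\<Union>u\<in>?P. cylinder A u) = space \<pi>"
  proof -
    have "x \<in> (\<Union>u\<in>?P. cylinder A u)" for x
      by (rule UN_I[of "restrict x A"]) (simp_all add: cylinder_def)
    then show ?thesis unfolding space_\<pi> by (intro equalityI subsetI UNIV_I)
  qed
  finally have total: "(\<Sum>u\<in>?P - {u0}. prob (cylinder A u)) = 1 - prob (all_z A)"
    using sum.remove[OF finP u0, of "\<lambda>u. prob (cylinder A u)"] by (simp add: prob_space all_z)
  have "(\<Sum>u\<in>?P. \<bar>measure (dirac_const z) (cylinder A u) - prob (cylinder A u)\<bar>)
      = (1 - prob (all_z A)) + (\<Sum>u\<in>?P - {u0}. prob (cylinder A u))"
    unfolding sum.remove[OF finP u0]
    using dirac[OF u0] by (intro arg_cong2[where f = "(+)"] sum.cong) (simp_all add: dirac all_z)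
  then show ?thesis by (simp add: tv_on_def total)
qed

lemma tv_on_interval_le:
  "tv_on {a..b} (dirac_const z) \<pi>
     \<le> 1 - (1 - \<epsilon>) ^ (\<Sum>s=1..card {a..b}. 1 + s * (r - 1)) * (1 - 27 * \<epsilon> / (1 - 27 * \<epsilon>))"
  using prob_all_z_interval[of a b] by (simp add: tv_on_dirac_const)

end

section \<open>The distance to the Dirac mass\<close>

text \<open>The bound vanishes at \<open>\<epsilon> = 0\<close> and has derivative \<open>C + 27\<close> there.\<close>
lemma bound_asymp_equiv:
  "(\<lambda>\<epsilon>::real. 1 - (1 - \<epsilon>) ^ C * (1 - 27 * \<epsilon> / (1 - 27 * \<epsilon>))) \<sim>[at_right 0] (\<lambda>\<epsilon>. (real C + 27) * \<epsilon>)"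
proof (rule asymp_equivI'_const)
  let ?g = "\<lambda>\<epsilon>::real. 1 - (1 - \<epsilon>) ^ C * (1 - 27 * \<epsilon> / (1 - 27 * \<epsilon>))"
  have "(?g has_real_derivative (real C + 27)) (at 0)"
    by (auto intro!: derivative_eq_intros)
  then have "((\<lambda>\<epsilon>. ?g \<epsilon> / \<epsilon>) \<longlongrightarrow> real C + 27) (at 0)"
    by (simp add: has_field_derivative_iff)
  then show "((\<lambda>\<epsilon>. ?g \<epsilon> / \<epsilon>) \<longlongrightarrow> real C + 27) (at_right 0)"
    by (rule filterlim_mono) (auto simp: at_le)
qed simp

theorem theorem4p2:
  fixes z :: "'a::finite"
    and N :: "int set" and k :: int and r :: nat
    and f :: "'a config \<Rightarrow> 'a" and F :: "'a config \<Rightarrow> 'a config"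
    and \<phi> :: "real \<Rightarrow> 'a config \<Rightarrow> 'a \<Rightarrow> real"
    and F_eps :: "real \<Rightarrow> 'a config \<Rightarrow> 'a config measure"
    and \<pi> :: "real \<Rightarrow> 'a config measure"
  assumes "N = {k..<k + int r}" and "2 \<le> r"
    and "is_CA N f F"
    and "spreading_state N F z"
    and "\<And>\<epsilon>. 0 < \<epsilon> \<Longrightarrow> is_PCA N (\<phi> \<epsilon>) (F_eps \<epsilon>)"
    and "\<And>\<epsilon>. 0 < \<epsilon> \<Longrightarrow> eps_perturbation \<epsilon> N f (\<phi> \<epsilon>)"
    and "\<And>\<epsilon>. 0 < \<epsilon> \<Longrightarrow> state_positive N z (\<phi> \<epsilon>)"
    and "\<And>\<epsilon>. 0 < \<epsilon> \<Longrightarrow> invariant_prob (F_eps \<epsilon>) (\<pi> \<epsilon>)"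
  shows "\<exists>C :: nat \<Rightarrow> nat. \<forall>a b :: int.
      (\<forall>\<epsilon>. 0 < \<epsilon> \<and> 27 * \<epsilon> < 1 \<longrightarrow>
         tv_on {a..b} (dirac_const z) (\<pi> \<epsilon>)
           \<le> 1 - (1 - \<epsilon>) ^ C (card {a..b}) * (1 - 27 * \<epsilon> / (1 - 27 * \<epsilon>))) \<and>
      (\<lambda>\<epsilon>. 1 - (1 - \<epsilon>) ^ C (card {a..b}) * (1 - 27 * \<epsilon> / (1 - 27 * \<epsilon>)))
        \<sim>[at_right 0] (\<lambda>\<epsilon>. (real (C (card {a..b})) + 27) * \<epsilon>)"
proof (intro exI allI conjI impI)
  fix a b :: int
  let ?C = "\<lambda>n. \<Sum>s=1..n. 1 + s * (r - 1)"
  show "(\<lambda>\<epsilon>. 1 - (1 - \<epsilon>) ^ ?C (card {a..b}) * (1 - 27 * \<epsilon> / (1 - 27 * \<epsilon>)))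
      \<sim>[at_right 0] (\<lambda>\<epsilon>. (real (?C (card {a..b})) + 27) * \<epsilon>)"
    by (rule bound_asymp_equiv)
  fix \<epsilon> :: real assume eps: "0 < \<epsilon> \<and> 27 * \<epsilon> < 1"
  interpret perturbed_spreading_CA z N k r f F \<epsilon> "\<phi> \<epsilon>" "F_eps \<epsilon>" "\<pi> \<epsilon>"
    using assms eps by unfold_locales auto
  show "tv_on {a..b} (dirac_const z) (\<pi> \<epsilon>)
      \<le> 1 - (1 - \<epsilon>) ^ ?C (card {a..b}) * (1 - 27 * \<epsilon> / (1 - 27 * \<epsilon>))"
    by (rule tv_on_interval_le)
qed

end
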